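(* Let $R$ be a finite commutative ring with identity with Artin decomposition $R\simeq R_1\times\cdots\times R_s$, where each $R_i$ is a (finite commutative) local ring. Then, for any $k\in\mathbb{N}$, $$G_R(k)\simeq G_{R_1}(k)\otimes\cdots\otimes G_{R_s}(k).$$
   Context: For a commutative ring $R$ with identity and a positive integer $k$, $R^*$ is the group of units and $U_{R,k}=\{x^k:x\in R^*\}$. For an abelian group $A$ and $S\subseteq A$ with $0\notin S$, $X(A,S)$ denotes the Cayley digraph with vertex set $A$ and an arc from $v$ to $w$ iff $w-v\in S$. Define $G_R(k)=X(R,U_{R,k})$. The Kronecker product $\Gamma_1\otimes\cdots\otimes\Gamma_s$ of (di)graphs has vertex set $V(\Gamma_1)\times\cdots\times V(\Gamma_s)$, with an arc from $(v_1,\dots,v_s)$ to $(w_1,\dots,w_s)$ iff there is an arc from $v_i$ to $w_i$ in $\Gamma_i$ for every $i$. $\simeq$ between graphs denotes (di)graph isomorphism. *)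

theory Defs
  imports
    "HOL-Algebra.Chinese_Remainder"
    "Graph_Theory.Pair_Digraph"
    "Graph_Theory.Digraph_Isomorphism"
begin

text \<open>The zero ring has no maximal ideal, so it is not local.\<close>

definition local_ring :: "('a, 'm) ring_scheme \<Rightarrow> bool"
  where "local_ring R \<longleftrightarrow> cring R \<and> (\<exists>!I. maximalideal I R)"

definition unit_powers :: "('a, 'm) ring_scheme \<Rightarrow> nat \<Rightarrow> 'a set"
  where "unit_powers R k = {x [^]\<^bsub>R\<^esub> k | x. x \<in> Units R}"

text \<open>
  The group is written multiplicatively, as everywhere in HOL-Algebra: for the
  additive group \<open>add_monoid R\<close> of a ring, \<open>w \<otimes> inv v\<close> is the difference \<open>w \<ominus>\<^bsub>R\<^esub> v\<close>.
  The definition makes sense for every \<open>S\<close>; the usual requirement that \<open>S\<close> avoids the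
  neutral element excludes loops.
\<close>

definition cayley_digraph :: "('a, 'm) monoid_scheme \<Rightarrow> 'a set \<Rightarrow> 'a pair_pre_digraph"
  where "cayley_digraph A S =
    \<lparr>pverts = carrier A,
     parcs = {(v, w). v \<in> carrier A \<and> w \<in> carrier A \<and> w \<otimes>\<^bsub>A\<^esub> inv\<^bsub>A\<^esub> v \<in> S}\<rparr>"

definition unit_power_digraph :: "('a, 'm) ring_scheme \<Rightarrow> nat \<Rightarrow> 'a pair_pre_digraph"
  where "unit_power_digraph R k = cayley_digraph (add_monoid R) (unit_powers R k)"

text \<open>Vertex tuples are lists, matching the elements of \<open>RDirProd_list\<close>.\<close>

definition kronecker_product :: "'a pair_pre_digraph list \<Rightarrow> 'a list pair_pre_digraph"
  where "kronecker_product Gs =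
    (let V = {vs. length vs = length Gs \<and> (\<forall>i < length Gs. vs ! i \<in> pverts (Gs ! i))}
     in \<lparr>pverts = V,
         parcs = {(vs, ws). vs \<in> V \<and> ws \<in> V \<and>
                   (\<forall>i < length Gs. (vs ! i, ws ! i) \<in> parcs (Gs ! i))}\<rparr>)"

text \<open>In a nonzero ring, the connection set of the Cayley digraph avoids zero.\<close>

lemma zero_notin_unit_powers:
  assumes "ring R" and "\<one>\<^bsub>R\<^esub> \<noteq> \<zero>\<^bsub>R\<^esub>"
  shows "\<zero>\<^bsub>R\<^esub> \<notin> unit_powers R k"
proof
  interpret ring R by fact
  assume "\<zero>\<^bsub>R\<^esub> \<in> unit_powers R k"
  then obtain x where x: "x \<in> Units R" "x [^]\<^bsub>R\<^esub> k = \<zero>\<^bsub>R\<^esub>"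
    unfolding unit_powers_def by force
  have "x [^]\<^bsub>R\<^esub> k \<in> Units R"
    by (induction k) (use x(1) in auto)
  then have "\<zero>\<^bsub>R\<^esub> \<in> Units R" by (simp add: x(2))
  then show False using assms(2) Units_r_inv Units_inv_closed l_null by metis
qed

end

theory Submission
  imports Defs
begin

text \<open>
  A tuple in a direct product of rings is a unit exactly when each entry is one, and powers,
  like sums and differences, are taken entry by entry. So \<open>w - v\<close> is the \<open>k\<close>-th power of a unit
  of the product iff, in each factor \<open>i\<close>, the difference \<open>w\<^sub>i - v\<^sub>i\<close> is the \<open>k\<close>-th power of a
  unit; that is adjacency in the Kronecker product. Hence the unit-power digraph of
  the product ring is not merely isomorphic to the Kronecker product of the digraphs of the
  factors but equal to it (\<open>unit_power_digraph_RDirProd_list\<close>), vertices being tuples in both.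

  It remains to move from the product to the given ring. A ring homomorphism preserves
  differences, units and powers, so it maps arcs to arcs (\<open>ring_hom_arc\<close>); applied to a ring
  isomorphism and to its inverse, this gives a digraph isomorphism. The same lemma, applied to the
  coordinate projections, proves one inclusion between the arc sets of the product digraphs.
\<close>

lemma unit_power_digraph_verts [simp]: "pverts (unit_power_digraph R k) = carrier R"
  by (simp add: unit_power_digraph_def cayley_digraph_def)

lemma unit_power_digraph_arc_iff:
  "(v, w) \<in> parcs (unit_power_digraph R k) \<longleftrightarrow>
     v \<in> carrier R \<and> w \<in> carrier R \<and> w \<ominus>\<^bsub>R\<^esub> v \<in> unit_powers R k"
  by (simp add: unit_power_digraph_def cayley_digraph_def a_minus_def a_inv_def)

lemma ring_hom_arc:
  assumes "ring R" and "ring S" and h: "h \<in> ring_hom R S"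
    and arc: "(v, w) \<in> parcs (unit_power_digraph R k)"
  shows "(h v, h w) \<in> parcs (unit_power_digraph S k)"
proof -
  interpret ring_hom_ring R S h
    using assms(1-3) by (intro ring_hom_ringI2)
  from arc have v: "v \<in> carrier R" and w: "w \<in> carrier R"
    and d: "w \<ominus>\<^bsub>R\<^esub> v \<in> unit_powers R k"
    by (auto simp: unit_power_digraph_arc_iff)
  from d obtain x where x: "x \<in> Units R" "w \<ominus>\<^bsub>R\<^esub> v = x [^]\<^bsub>R\<^esub> k"
    by (auto simp: unit_powers_def)
  have "h w \<ominus>\<^bsub>S\<^esub> h v = h (w \<ominus>\<^bsub>R\<^esub> v)"
    using v w by (simp add: a_minus_def)
  also have "\<dots> = h x [^]\<^bsub>S\<^esub> k"
    using x(2) hom_nat_pow[OF R.Units_closed[OF x(1)], of k] by simp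
  finally have diff: "h w \<ominus>\<^bsub>S\<^esub> h v = h x [^]\<^bsub>S\<^esub> k" .
  obtain y where "y \<in> carrier R" "y \<otimes>\<^bsub>R\<^esub> x = \<one>\<^bsub>R\<^esub>" "x \<otimes>\<^bsub>R\<^esub> y = \<one>\<^bsub>R\<^esub>"
    using x(1) by (auto simp: Units_def)
  then have "h x \<in> Units S"
    using x(1) R.Units_closed[OF x(1)] unfolding Units_def
    by simp (metis hom_closed hom_mult hom_one)
  with diff show ?thesis
    using v w by (auto simp: unit_power_digraph_arc_iff unit_powers_def)
qed

text \<open>
  An arc of \<open>with_proj G\<close> is the pair of its endpoints, so a vertex bijection forces the map on arcs,
  and agreement of adjacency is all that an isomorphism demands.
\<close>

lemma digraph_iso_with_projI:
  assumes "pair_wf_digraph G" and "pair_wf_digraph H"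
    and bij: "bij_betw f (pverts G) (pverts H)"
    and arcs: "\<And>u v. u \<in> pverts G \<Longrightarrow> v \<in> pverts G \<Longrightarrow>
      (u, v) \<in> parcs G \<longleftrightarrow> (f u, f v) \<in> parcs H"
  shows "digraph_iso (with_proj G) (with_proj H)"
proof -
  interpret G: pair_wf_digraph G by fact
  interpret H: pair_wf_digraph H by fact
  define F where "F = \<lparr>iso_verts = f, iso_arcs = map_prod f f, iso_head = snd, iso_tail = fst\<rparr>"
  have inj: "inj_on f (pverts G)" and img: "f ` pverts G = pverts H"
    using bij by (auto simp: bij_betw_def)
  have "inj_on (map_prod f f) (parcs G)"
    by (rule inj_on_subset[OF map_prod_inj_on[OF inj inj]]) (auto dest: G.wellformed')
  moreover have "wf_digraph (with_proj G)"
    using assms(1) by (simp add: wf_digraph_wp_iff)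
  ultimately have iso: "pre_digraph.digraph_isomorphism (with_proj G) F"
    using inj by (auto simp: pre_digraph.digraph_isomorphism_def F_def)
  have "map_prod f f ` parcs G \<subseteq> parcs H"
    using arcs G.in_arcsD1 G.in_arcsD2 by fast
  moreover have "parcs H \<subseteq> map_prod f f ` parcs G"
  proof (clarify)
    fix a b assume ab: "(a, b) \<in> parcs H"
    then obtain u v where uv: "u \<in> pverts G" "v \<in> pverts G" "a = f u" "b = f v"
      using H.wellformed'[OF ab] img by blast
    then have "(u, v) \<in> parcs G" using ab arcs by blast
    then show "(a, b) \<in> map_prod f f ` parcs G"
      using uv by force
  qed
  ultimately have "parcs H = map_prod f f ` parcs G"
    by (intro equalityI)
  then have "with_proj H = app_iso F (with_proj G)"
    by (intro pre_digraph.equality) (simp_all add: F_def img)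
  with iso show ?thesis
    unfolding digraph_iso_def by blast
qed

lemma ring_iso_imp_unit_power_digraph_iso:
  assumes R: "ring R" and S: "ring S" and "R \<simeq> S"
  shows "digraph_iso (with_proj (unit_power_digraph R k)) (with_proj (unit_power_digraph S k))"
proof -
  obtain h where h: "h \<in> ring_iso R S"
    using \<open>R \<simeq> S\<close> by (auto simp: is_ring_iso_def)
  then have bij: "bij_betw h (carrier R) (carrier S)" and hom: "h \<in> ring_hom R S"
    by (auto simp: ring_iso_def)
  define g where "g = inv_into (carrier R) h"
  have g: "g \<in> ring_hom S R"
    using ring_iso_set_sym[OF R h] by (simp add: ring_iso_def g_def)
  have gh: "g (h u) = u" if "u \<in> carrier R" for u
    using bij that by (simp add: g_def bij_betw_def)
  have arcs: "(u, v) \<in> parcs (unit_power_digraph R k) \<longleftrightarrow> (h u, h v) \<in> parcs (unit_power_digraph S k)"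
    if "u \<in> carrier R" "v \<in> carrier R" for u v
    using ring_hom_arc[OF R S hom] ring_hom_arc[OF S R g] gh that by metis
  show ?thesis
    by (rule digraph_iso_with_projI[where f = h])
       (use bij arcs in \<open>auto simp: pair_wf_digraph_def unit_power_digraph_arc_iff\<close>)
qed

text \<open>
  The operations of \<open>RDirProd_list\<close> are transported along a choice of preimages inside the carrier
  of the binary product, which pins down the entries only for tuples in the carrier. The proof goes
  through the homomorphism that prepends an entry.
\<close>

lemma RDirProd_list_Cons:
  assumes "a \<in> carrier R" and "as \<in> carrier (RDirProd_list Rs)"
    and "b \<in> carrier R" and "bs \<in> carrier (RDirProd_list Rs)"
  shows RDirProd_list_mult_Cons: "(a # as) \<otimes>\<^bsub>RDirProd_list (R # Rs)\<^esub> (b # bs) =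
      (a \<otimes>\<^bsub>R\<^esub> b) # (as \<otimes>\<^bsub>RDirProd_list Rs\<^esub> bs)"
    and RDirProd_list_add_Cons: "(a # as) \<oplus>\<^bsub>RDirProd_list (R # Rs)\<^esub> (b # bs) =
      (a \<oplus>\<^bsub>R\<^esub> b) # (as \<oplus>\<^bsub>RDirProd_list Rs\<^esub> bs)"
proof -
  have mem: "(a, as) \<in> carrier (RDirProd R (RDirProd_list Rs))"
    "(b, bs) \<in> carrier (RDirProd R (RDirProd_list Rs))"
    using assms by (auto simp: RDirProd_carrier)
  note hom = RDirProd_list_hom1[of R Rs]
  show "(a # as) \<otimes>\<^bsub>RDirProd_list (R # Rs)\<^esub> (b # bs) =
      (a \<otimes>\<^bsub>R\<^esub> b) # (as \<otimes>\<^bsub>RDirProd_list Rs\<^esub> bs)"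
    using ring_hom_mult[OF hom mem]
    by (simp add: RDirProd_def DirProd_def monoid.defs)
  show "(a # as) \<oplus>\<^bsub>RDirProd_list (R # Rs)\<^esub> (b # bs) =
      (a \<oplus>\<^bsub>R\<^esub> b) # (as \<oplus>\<^bsub>RDirProd_list Rs\<^esub> bs)"
    using ring_hom_add[OF hom mem]
    by (simp add: RDirProd_def DirProd_def monoid.defs)
qed

lemma RDirProd_list_nth:
  assumes "as \<in> carrier (RDirProd_list Rs)" and "bs \<in> carrier (RDirProd_list Rs)"
    and "i < length Rs"
  shows RDirProd_list_nth_mult: "(as \<otimes>\<^bsub>RDirProd_list Rs\<^esub> bs) ! i = as ! i \<otimes>\<^bsub>Rs ! i\<^esub> bs ! i"
    and RDirProd_list_nth_add: "(as \<oplus>\<^bsub>RDirProd_list Rs\<^esub> bs) ! i = as ! i \<oplus>\<^bsub>Rs ! i\<^esub> bs ! i"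
proof -
  from assms have "(as \<otimes>\<^bsub>RDirProd_list Rs\<^esub> bs) ! i = as ! i \<otimes>\<^bsub>Rs ! i\<^esub> bs ! i \<and>
      (as \<oplus>\<^bsub>RDirProd_list Rs\<^esub> bs) ! i = as ! i \<oplus>\<^bsub>Rs ! i\<^esub> bs ! i"
  proof (induction Rs arbitrary: i as bs)
    case (Cons R Rs)
    then show ?case
      by (cases i) (auto simp: RDirProd_list_carrier RDirProd_list_Cons)
  qed simp
  then show "(as \<otimes>\<^bsub>RDirProd_list Rs\<^esub> bs) ! i = as ! i \<otimes>\<^bsub>Rs ! i\<^esub> bs ! i"
    and "(as \<oplus>\<^bsub>RDirProd_list Rs\<^esub> bs) ! i = as ! i \<oplus>\<^bsub>Rs ! i\<^esub> bs ! i"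
    by simp_all
qed

lemma RDirProd_list_nth_one:
  "i < length Rs \<Longrightarrow> \<one>\<^bsub>RDirProd_list Rs\<^esub> ! i = \<one>\<^bsub>Rs ! i\<^esub>"
proof (induction Rs arbitrary: i)
  case (Cons R Rs)
  then show ?case by (cases i) (auto simp: RDirProd_list_one)
qed simp

text \<open>
  Because each projection is a homomorphism, differences and powers in the product are
  entrywise as well, without further recursions over the list of factors.
\<close>

lemma RDirProd_list_proj_hom:
  assumes "i < length Rs"
  shows "(\<lambda>as. as ! i) \<in> ring_hom (RDirProd_list Rs) (Rs ! i)"
  using assms
  by (intro ring_hom_memI)
     (simp_all add: RDirProd_list_carrier_mem RDirProd_list_nth_one RDirProd_list_nth_mult
       RDirProd_list_nth_add)

lemma RDirProd_list_eqI:
  assumes "as \<in> carrier (RDirProd_list Rs)" and "bs \<in> carrier (RDirProd_list Rs)"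
    and "\<And>i. i < length Rs \<Longrightarrow> as ! i = bs ! i"
  shows "as = bs"
  using assms by (intro nth_equalityI) (auto simp: RDirProd_list_carrier_mem)

lemma RDirProd_list_UnitsI:
  assumes ring: "\<And>i. i < length Rs \<Longrightarrow> ring (Rs ! i)"
    and len: "length xs = length Rs"
    and unit: "\<And>i. i < length Rs \<Longrightarrow> xs ! i \<in> Units (Rs ! i)"
  shows "xs \<in> Units (RDirProd_list Rs)"
proof -
  interpret P: ring "RDirProd_list Rs" using ring by (rule RDirProd_list_is_ring)
  have xs: "xs \<in> carrier (RDirProd_list Rs)"
    using len unit by (auto intro!: RDirProd_list_carrier_memI simp: Units_def)
  define ys where "ys = map (\<lambda>i. inv\<^bsub>Rs ! i\<^esub> (xs ! i)) [0..<length Rs]"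
  have [simp]: "monoid (Rs ! i)" if "i < length Rs" for i
    using ring[OF that] by (simp add: ring_def)
  have ys: "ys \<in> carrier (RDirProd_list Rs)"
    using unit by (auto intro!: RDirProd_list_carrier_memI monoid.Units_inv_closed simp: ys_def)
  have "ys \<otimes>\<^bsub>RDirProd_list Rs\<^esub> xs = \<one>\<^bsub>RDirProd_list Rs\<^esub>"
    using xs ys len unit
    by (intro RDirProd_list_eqI)
       (auto simp: RDirProd_list_nth_mult RDirProd_list_nth_one ys_def monoid.Units_l_inv)
  moreover have "xs \<otimes>\<^bsub>RDirProd_list Rs\<^esub> ys = \<one>\<^bsub>RDirProd_list Rs\<^esub>"
    using xs ys len unit
    by (intro RDirProd_list_eqI)
       (auto simp: RDirProd_list_nth_mult RDirProd_list_nth_one ys_def monoid.Units_r_inv)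
  ultimately show ?thesis
    using xs ys by (auto simp: Units_def)
qed

text \<open>
  For the inclusion that the projections do not give, the \<open>k\<close>-th roots chosen independently in the
  factors are assembled into a single unit of the product.
\<close>

lemma RDirProd_list_unit_powersI:
  assumes ring: "\<And>i. i < length Rs \<Longrightarrow> ring (Rs ! i)"
    and ds: "ds \<in> carrier (RDirProd_list Rs)"
    and pow: "\<And>i. i < length Rs \<Longrightarrow> ds ! i \<in> unit_powers (Rs ! i) k"
  shows "ds \<in> unit_powers (RDirProd_list Rs) k"
proof -
  have P: "ring (RDirProd_list Rs)" using ring by (rule RDirProd_list_is_ring)
  interpret P: ring "RDirProd_list Rs" by (rule P)
  obtain x where x: "\<And>i. i < length Rs \<Longrightarrow> x i \<in> Units (Rs ! i) \<and> ds ! i = x i [^]\<^bsub>Rs ! i\<^esub> k"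
    using pow unfolding unit_powers_def by simp metis
  define xs where "xs = map x [0..<length Rs]"
  have xs: "xs \<in> Units (RDirProd_list Rs)"
    using x by (intro RDirProd_list_UnitsI ring) (auto simp: xs_def)
  have "ds = xs [^]\<^bsub>RDirProd_list Rs\<^esub> k"
  proof (rule RDirProd_list_eqI[OF ds])
    show "xs [^]\<^bsub>RDirProd_list Rs\<^esub> k \<in> carrier (RDirProd_list Rs)"
      using P.nat_pow_closed[OF P.Units_closed[OF xs]] .
    fix i assume i: "i < length Rs"
    interpret proj: ring_hom_ring "RDirProd_list Rs" "Rs ! i" "\<lambda>as. as ! i"
      using P ring[OF i] RDirProd_list_proj_hom[OF i] by (rule ring_hom_ringI2)
    show "ds ! i = (xs [^]\<^bsub>RDirProd_list Rs\<^esub> k) ! i"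
      using x[OF i] i proj.hom_nat_pow[OF P.Units_closed[OF xs], of k] by (simp add: xs_def)
  qed
  then show ?thesis
    using xs by (auto simp: unit_powers_def)
qed

lemma unit_power_digraph_RDirProd_list:
  assumes ring: "\<And>i. i < length Rs \<Longrightarrow> ring (Rs ! i)"
  shows "unit_power_digraph (RDirProd_list Rs) k =
    kronecker_product (map (\<lambda>S. unit_power_digraph S k) Rs)"
    (is "?G = ?K")
proof -
  let ?P = "RDirProd_list Rs"
  have P: "ring ?P" using ring by (rule RDirProd_list_is_ring)
  interpret P: ring ?P by (rule P)
  have verts: "vs \<in> carrier ?P \<longleftrightarrow>
      length vs = length Rs \<and> (\<forall>i < length Rs. vs ! i \<in> carrier (Rs ! i))" for vs
    by (auto simp: RDirProd_list_carrier_mem intro: RDirProd_list_carrier_memI)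
  have "(vs, ws) \<in> parcs ?G \<longleftrightarrow> vs \<in> carrier ?P \<and> ws \<in> carrier ?P \<and>
      (\<forall>i < length Rs. (vs ! i, ws ! i) \<in> parcs (unit_power_digraph (Rs ! i) k))"
    (is "_ \<longleftrightarrow> ?arcs") for vs ws
  proof
    assume "(vs, ws) \<in> parcs ?G"
    then show ?arcs
      using ring_hom_arc[OF P ring RDirProd_list_proj_hom]
      by (auto simp: unit_power_digraph_arc_iff)
  next
    assume A: ?arcs
    have "(ws \<ominus>\<^bsub>?P\<^esub> vs) ! i \<in> unit_powers (Rs ! i) k" if i: "i < length Rs" for i
    proof -
      interpret proj: ring_hom_ring ?P "Rs ! i" "\<lambda>as. as ! i"
        using P ring[OF i] RDirProd_list_proj_hom[OF i] by (rule ring_hom_ringI2)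
      have "(ws \<ominus>\<^bsub>?P\<^esub> vs) ! i = ws ! i \<ominus>\<^bsub>Rs ! i\<^esub> vs ! i"
        using A by (simp add: a_minus_def)
      then show ?thesis
        using A i by (simp add: unit_power_digraph_arc_iff)
    qed
    then have "ws \<ominus>\<^bsub>?P\<^esub> vs \<in> unit_powers ?P k"
      using A by (intro RDirProd_list_unit_powersI ring) auto
    then show "(vs, ws) \<in> parcs ?G"
      using A by (simp add: unit_power_digraph_arc_iff)
  qed
  then show ?thesis
    by (intro pair_pre_digraph.equality)
       (auto simp: kronecker_product_def Let_def verts)
qed

theorem proposition6p1:
  fixes R :: "('a, 'm) ring_scheme"
    and Rs :: "('b, 'n) ring_scheme list"
    and k :: nat
  assumes "cring R"
    and "finite (carrier R)"
    and "Rs \<noteq> []"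
    and "\<And>S. S \<in> set Rs \<Longrightarrow> local_ring S"
    and "\<And>S. S \<in> set Rs \<Longrightarrow> finite (carrier S)"
    and "R \<simeq> RDirProd_list Rs"
    and "k \<ge> 1"
  shows "digraph_iso
           (with_proj (unit_power_digraph R k))
           (with_proj (kronecker_product (map (\<lambda>S. unit_power_digraph S k) Rs)))"
proof -
  have R: "ring R"
    using assms(1) by (rule cring.axioms)
  have Rs: "ring (Rs ! i)" if "i < length Rs" for i
    using assms(4)[OF nth_mem[OF that]] by (auto simp: local_ring_def dest: cring.axioms)
  have "ring (RDirProd_list Rs)"
    using Rs by (rule RDirProd_list_is_ring)
  from ring_iso_imp_unit_power_digraph_iso[OF R this assms(6), of k]
  show ?thesis
    using unit_power_digraph_RDirProd_list[of Rs k] Rs by simp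
qed

end
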